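(* Let $(\alpha_k)_{k\in\mathbb{N}}$ be an increasing sequence of positive integers, let $k\in\mathbb{N}$, and let $x\in I_2(e_0+e_1)\subset I_0\setminus I_1$. Then $$\left|\sum_{j=2^{2\alpha_k}}^{2^{2\alpha_k+1}-1}\frac{D_j(x)}{2^{2\alpha_k+1}-j}\right| =\left|\sum_{j=2^{2\alpha_k-1}}^{2^{2\alpha_k}-1}\frac{w_{2j+1}(x)}{2^{2\alpha_k+1}-2j-1}\right| =\left|\sum_{j=2^{2\alpha_k-1}}^{2^{2\alpha_k}-1}\frac{w_{2j}(x)}{2^{2\alpha_k+1}-2j-1}\right|\ge\frac13 .$$
   Context: Notation: $\mathbb{N}_+$ is the set of positive integers and $\mathbb{N}=\mathbb{N}_+\cup\{0\}$. $Z_2=\{0,1\}$ is the discrete group with addition modulo 2. $G$ is the complete direct product of countably many copies of $Z_2$; its elements are sequences $x=(x_0,x_1,\dots,x_j,\dots)$ with $x_k\in\{0,1\}$, and addition is coordinatewise modulo 2. For $x\in G$ put $I_0(x):=G$ and $I_n(x):=\{y\in G:\ y_0=x_0,\dots,y_{n-1}=x_{n-1}\}$ for $n\in\mathbb{N}_+$; $I_n:=I_n(0)$. $e_n\in G$ is the sequence whose $n$-th coordinate is $1$ and all other coordinates are $0$. Rademacher functions: $r_k(x):=(-1)^{x_k}$. Walsh functions: if $n=\sum_{j\ge 0}n_j2^j$ with $n_j\in\{0,1\}$ is the binary expansion of $n\in\mathbb{N}$, then $w_n(x):=\prod_{k=0}^{\infty}r_k(x)^{n_k}$. Walsh–Dirichlet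 kernels: $D_n:=\sum_{k=0}^{n-1}w_k$ for $n\in\mathbb{N}_+$. *)

theory Defs
  imports "HOL-Analysis.Analysis" "HOL-Library.Z2" "HOL-Library.Function_Algebras"
begin

(* Elements of the product group of countably many copies of Z_2; the pointwise
   group operations are the instances of Function_Algebras. *)
type_synonym dyadic_group = "nat \<Rightarrow> bit"

definition dyadic_interval :: "nat \<Rightarrow> dyadic_group \<Rightarrow> dyadic_group set" where
  "dyadic_interval n x = {y. \<forall>i<n. y i = x i}"

definition unit_seq :: "nat \<Rightarrow> dyadic_group" where
  "unit_seq n = (\<lambda>i. if i = n then 1 else 0)"

definition binary_digit :: "nat \<Rightarrow> nat \<Rightarrow> nat" where
  "binary_digit n j = n div 2 ^ j mod 2"

definition rademacher :: "nat \<Rightarrow> dyadic_group \<Rightarrow> real" where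
  "rademacher k x = (-1) ^ of_bit (x k)"

(* All but finitely many factors of the product are 1. *)
definition walsh :: "nat \<Rightarrow> dyadic_group \<Rightarrow> real" where
  "walsh n x = (\<Prod>k. rademacher k x ^ binary_digit n k)"

definition walsh_dirichlet :: "nat \<Rightarrow> dyadic_group \<Rightarrow> real" where
  "walsh_dirichlet n x = (\<Sum>k<n. walsh k x)"

end

theory Submission
  imports Defs
begin

text \<open>
  On the interval in question the first two Rademacher functions both equal \<open>- 1\<close>, hence
  \<open>w\<^bsub>2n+1\<^esub>(x) = - w\<^bsub>2n\<^esub>(x)\<close> and \<open>w\<^bsub>4n+2\<^esub>(x) = - w\<^bsub>4n\<^esub>(x)\<close>.

  The first relation makes consecutive terms of a Dirichlet kernel cancel, so that \<open>D\<^bsub>2n\<^esub>(x) = 0\<close>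
  and \<open>D\<^bsub>2n+1\<^esub>(x) = w\<^bsub>2n\<^esub>(x)\<close>: only the odd indices \<open>j\<close> of the first sum survive, and they
  give the last sum. The middle sum is its negative.

  The second relation allows the terms of the last sum to be paired. Counting the pairs from the
  upper end, by \<open>s = 0, 1, \<dots>\<close>, the denominators of pair \<open>s\<close> are \<open>4s + 3\<close> and \<open>4s + 1\<close>,
  and the pair contributes \<open>1/(4s+1) - 1/(4s+3) = 2/((4s+1)(4s+3))\<close> up to sign
  (\<open>pair_of_even_walsh_terms\<close>). The signs are beyond control, but the pair \<open>s = 0\<close> has size
  \<open>2/3\<close>, whereas all the others together have size at most
  \<open>1/6\<close> (\<open>signed_leibniz_sum_lower_bound\<close>). So the sum has modulus at least
  \<open>1/2\<close>.
\<close>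

section \<open>Walsh functions and the shift\<close>

lemma walsh_eq_finite_prod:
  assumes "n < 2 ^ K"
  shows "walsh n x = (\<Prod>k<K. rademacher k x ^ binary_digit n k)"
  unfolding walsh_def
proof (rule prodinf_finite)
  fix k assume "k \<notin> {..<K}"
  then have "(2::nat) ^ K \<le> 2 ^ k" by simp
  with assms have "n < 2 ^ k" by (rule less_le_trans)
  then have "binary_digit n k = 0" by (simp add: binary_digit_def)
  then show "rademacher k x ^ binary_digit n k = 1" by simp
qed simp

text \<open>Splitting off the lowest binary digit turns the relations between Walsh functions of
  neighbouring indices into computations with a single Rademacher function.\<close>

lemma walsh_shift:
  "walsh n x = rademacher 0 x ^ (n mod 2) * walsh (n div 2) (\<lambda>i. x (Suc i))"
proof -
  have "n div 2 < 2 ^ n" "n < 2 ^ Suc n"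
    using less_exp[of n] less_exp[of "Suc n"] by linarith+
  then have "walsh n x = (\<Prod>k<Suc n. rademacher k x ^ binary_digit n k)"
    and "walsh (n div 2) (\<lambda>i. x (Suc i))
      = (\<Prod>k<n. rademacher k (\<lambda>i. x (Suc i)) ^ binary_digit (n div 2) k)"
    by (simp_all only: walsh_eq_finite_prod)
  then show ?thesis
    by (simp add: prod.lessThan_Suc_shift binary_digit_def rademacher_def div_mult2_eq
        del: prod.lessThan_Suc)
qed

lemma abs_walsh: "\<bar>walsh n x\<bar> = 1"
proof -
  have "\<bar>rademacher k x\<bar> = 1" for k
    by (simp add: rademacher_def power_abs)
  then show ?thesis
    by (simp add: walsh_eq_finite_prod[OF less_exp] abs_prod power_abs)
qed

lemma walsh_odd:
  assumes "x 0 = 1"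
  shows "walsh (2 * n + 1) x = - walsh (2 * n) x"
  using walsh_shift[of "2 * n + 1" x] walsh_shift[of "2 * n" x] assms
  by (simp add: rademacher_def)

lemma walsh_twice_odd:
  assumes "x 1 = 1"
  shows "walsh (2 * (2 * n + 1)) x = - walsh (2 * (2 * n)) x"
  using walsh_shift[of "2 * (2 * n + 1)" x] walsh_shift[of "2 * (2 * n)" x]
    walsh_odd[of "\<lambda>i. x (Suc i)" n] assms
  by simp

section \<open>Dirichlet kernels\<close>

lemma walsh_dirichlet_even:
  assumes "x 0 = 1"
  shows "walsh_dirichlet (2 * n) x = 0"
  using walsh_odd[of x] assms
  by (induction n) (simp_all add: walsh_dirichlet_def)

lemma walsh_dirichlet_odd:
  assumes "x 0 = 1"
  shows "walsh_dirichlet (2 * n + 1) x = walsh (2 * n) x"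
  using walsh_dirichlet_even[of x n, OF assms] by (simp add: walsh_dirichlet_def)

lemma dirichlet_sum_eq_even_walsh_sum:
  fixes c :: real
  assumes "x 0 = 1" and "n > 0"
  shows "(\<Sum>j = 2 * m..2 * n - 1. walsh_dirichlet j x / (c - real j))
    = (\<Sum>j = m..n - 1. walsh (2 * j) x / (c - 2 * real j - 1))"
proof -
  have "2 * n - 1 = Suc (2 * (n - 1))" using assms(2) by simp
  then show ?thesis
    using walsh_dirichlet_even[of x, OF assms(1)] walsh_dirichlet_odd[of x, OF assms(1)]
    by (simp add: sum.in_pairs diff_diff_eq add.commute del: sum.cl_ivl_Suc)
qed

section \<open>The lower bound\<close>

text \<open>The summation index is shifted by one, so that these are all the pairs but the first.
  Replacing the factor \<open>4s + 5\<close> by \<open>4s + 3\<close> gives a telescoping series: the two factors of a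
  denominator then differ by \<open>4\<close>, the increment from one term to the next.\<close>

lemma leibniz_tail_bound:
  "(\<Sum>s<n. 2 / ((4 * real s + 5) * (4 * real s + 7))) \<le> 1 / 6 - 1 / (2 * (4 * real n + 3))"
proof (induction n)
  case (Suc n)
  have "2 / ((4 * real n + 5) * (4 * real n + 7)) \<le> 2 / ((4 * real n + 3) * (4 * real n + 7))"
    by (intro divide_left_mono mult_right_mono) auto
  also have "\<dots> = 1 / (2 * (4 * real n + 3)) - 1 / (2 * (4 * real n + 7))"
    by (simp add: divide_simps add_nonneg_eq_0_iff) (simp add: algebra_simps)
  finally show ?case using Suc by (simp add: algebra_simps)
qed simp

text \<open>With \<open>c s = 1\<close> for all \<open>s\<close> these are partial sums of Leibniz's series for \<open>\<pi> / 4\<close>, with its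
  terms taken in pairs. Its first pair exceeds the remaining ones so much that no choice of signs
  can bring the sum below \<open>1 / 2\<close> in modulus.\<close>

lemma signed_leibniz_sum_lower_bound:
  fixes c :: "nat \<Rightarrow> real"
  assumes "\<And>s. \<bar>c s\<bar> = 1" and "n > 0"
  shows "\<bar>\<Sum>s<n. c s * (2 / ((4 * real s + 1) * (4 * real s + 3)))\<bar> \<ge> 1 / 2"
proof -
  obtain m where n: "n = Suc m" using assms(2) by (cases n) auto
  define T where "T = (\<Sum>s<m. c (Suc s) * (2 / ((4 * real s + 5) * (4 * real s + 7))))"
  have "\<bar>T\<bar> \<le> (\<Sum>s<m. 2 / ((4 * real s + 5) * (4 * real s + 7)))"
    unfolding T_def by (rule order_trans[OF sum_abs]) (simp add: abs_mult assms(1))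
  also have "\<dots> \<le> 1 / 6"
    by (rule order_trans[OF leibniz_tail_bound]) simp
  finally have "\<bar>T\<bar> \<le> 1 / 6" .
  moreover have "(\<Sum>s<n. c s * (2 / ((4 * real s + 1) * (4 * real s + 3)))) = c 0 * (2 / 3) + T"
    unfolding n T_def sum.lessThan_Suc_shift by (simp add: algebra_simps)
  moreover have "\<bar>c 0 * (2 / 3)\<bar> = 2 / 3"
    by (simp add: abs_mult assms(1))
  ultimately show ?thesis by linarith
qed

text \<open>Here \<open>2q - 1 - s\<close> is the index of the pair that is \<open>s\<close> places below the last
  one, \<open>2q - 1\<close>.\<close>

lemma pair_of_even_walsh_terms:
  assumes "x 1 = 1" and "s < 2 * q"
  defines "l \<equiv> 2 * q - 1 - s"
  shows "walsh (2 * (2 * l)) x / (8 * real q - 2 * real (2 * l) - 1)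
      + walsh (2 * (2 * l + 1)) x / (8 * real q - 2 * real (2 * l + 1) - 1)
    = - walsh (2 * (2 * l)) x * (2 / ((4 * real s + 1) * (4 * real s + 3)))"
proof -
  have "real l = 2 * real q - 1 - real s"
    using assms(2) by (simp add: l_def of_nat_diff)
  then have "8 * real q - 2 * real (2 * l) - 1 = 4 * real s + 3"
    and "8 * real q - 2 * real (2 * l + 1) - 1 = 4 * real s + 1"
    by simp_all
  moreover have "w / (4 * real s + 3) + - w / (4 * real s + 1)
      = - w * (2 / ((4 * real s + 1) * (4 * real s + 3)))" for w
    by (simp add: divide_simps add_nonneg_eq_0_iff) (simp add: algebra_simps)
  ultimately show ?thesis
    by (simp only: walsh_twice_odd[of x, OF assms(1)])
qed

lemma even_walsh_sum_lower_bound: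
  assumes "x 1 = 1" and "q > 0"
  shows "\<bar>\<Sum>j = 2 * q..4 * q - 1. walsh (2 * j) x / (8 * real q - 2 * real j - 1)\<bar> \<ge> 1 / 2"
proof -
  define f where "f j = walsh (2 * j) x / (8 * real q - 2 * real j - 1)" for j
  have "(\<Sum>j = 2 * q..4 * q - 1. f j) = (\<Sum>l = q..2 * q - 1. f (2 * l) + f (2 * l + 1))"
  proof -
    have "4 * q - 1 = Suc (2 * (2 * q - 1))" using assms(2) by simp
    then show ?thesis by (simp add: sum.in_pairs del: sum.cl_ivl_Suc)
  qed
  also have "\<dots> = (\<Sum>s<q. f (2 * (2 * q - 1 - s)) + f (2 * (2 * q - 1 - s) + 1))"
    by (rule sum.reindex_bij_witness[of _ "\<lambda>s. 2 * q - 1 - s" "\<lambda>l. 2 * q - 1 - l"])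
      (use assms(2) in auto)
  also have "\<dots> = (\<Sum>s<q. - walsh (2 * (2 * (2 * q - 1 - s))) x
      * (2 / ((4 * real s + 1) * (4 * real s + 3))))"
    unfolding f_def by (intro sum.cong refl pair_of_even_walsh_terms assms(1)) auto
  finally show ?thesis
    using signed_leibniz_sum_lower_bound[of "\<lambda>s. - walsh (2 * (2 * (2 * q - 1 - s))) x" q]
      assms(2) by (simp add: f_def abs_walsh)
qed

section \<open>The estimate on the interval around \<open>e\<^sub>0 + e\<^sub>1\<close>\<close>

lemma dyadic_interval_unit_seqs_iff:
  "y \<in> dyadic_interval 2 (unit_seq 0 + unit_seq 1) \<longleftrightarrow> y 0 = 1 \<and> y 1 = 1"
  by (auto simp: dyadic_interval_def unit_seq_def numeral_2_eq_2 less_Suc_eq)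

theorem lemma2:
  fixes \<alpha> :: "nat \<Rightarrow> nat" and k :: nat and x :: dyadic_group
  assumes "incseq \<alpha>"
    and "\<And>i. \<alpha> i > 0"
    and "x \<in> dyadic_interval 2 (unit_seq 0 + unit_seq 1)"
  shows "dyadic_interval 2 (unit_seq 0 + unit_seq 1)
           \<subseteq> dyadic_interval 0 0 - dyadic_interval 1 0
    \<and> \<bar>\<Sum>j = 2 ^ (2 * \<alpha> k)..2 ^ (2 * \<alpha> k + 1) - 1.
          walsh_dirichlet j x / (2 ^ (2 * \<alpha> k + 1) - real j)\<bar>
      = \<bar>\<Sum>j = 2 ^ (2 * \<alpha> k - 1)..2 ^ (2 * \<alpha> k) - 1.
          walsh (2 * j + 1) x / (2 ^ (2 * \<alpha> k + 1) - 2 * real j - 1)\<bar>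
    \<and> \<bar>\<Sum>j = 2 ^ (2 * \<alpha> k - 1)..2 ^ (2 * \<alpha> k) - 1.
          walsh (2 * j + 1) x / (2 ^ (2 * \<alpha> k + 1) - 2 * real j - 1)\<bar>
      = \<bar>\<Sum>j = 2 ^ (2 * \<alpha> k - 1)..2 ^ (2 * \<alpha> k) - 1.
          walsh (2 * j) x / (2 ^ (2 * \<alpha> k + 1) - 2 * real j - 1)\<bar>
    \<and> \<bar>\<Sum>j = 2 ^ (2 * \<alpha> k - 1)..2 ^ (2 * \<alpha> k) - 1.
          walsh (2 * j) x / (2 ^ (2 * \<alpha> k + 1) - 2 * real j - 1)\<bar> \<ge> 1 / 3"
proof (intro conjI)
  show "dyadic_interval 2 (unit_seq 0 + unit_seq 1) \<subseteq> dyadic_interval 0 0 - dyadic_interval 1 0"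
    unfolding dyadic_interval_unit_seqs_iff subset_iff by (simp add: dyadic_interval_def)
  have x: "x 0 = 1" "x 1 = 1"
    using assms(3) by (simp_all only: dyadic_interval_unit_seqs_iff)
  obtain b where b: "\<alpha> k = Suc b" using assms(2)[of k] gr0_implies_Suc by blast
  define q :: nat where "q = 2 ^ (2 * b)"
  \<comment> \<open>\<open>\<alpha> k > 0\<close> enters here: the number \<open>q\<close> of pairs, a quarter of
    \<open>2 ^ (2 * \<alpha> k)\<close>, has to be an integer.\<close>
  have q: "q > 0" "2 ^ (2 * \<alpha> k - 1) = 2 * q" "2 ^ (2 * \<alpha> k) = 4 * q"
    "2 ^ (2 * \<alpha> k + 1) = 8 * q" "(2::real) ^ (2 * \<alpha> k + 1) = 8 * real q"
    by (simp_all add: q_def b)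
  show "\<bar>\<Sum>j = 2 ^ (2 * \<alpha> k)..2 ^ (2 * \<alpha> k + 1) - 1.
          walsh_dirichlet j x / (2 ^ (2 * \<alpha> k + 1) - real j)\<bar>
      = \<bar>\<Sum>j = 2 ^ (2 * \<alpha> k - 1)..2 ^ (2 * \<alpha> k) - 1.
          walsh (2 * j + 1) x / (2 ^ (2 * \<alpha> k + 1) - 2 * real j - 1)\<bar>"
    unfolding q walsh_odd[of x, OF x(1)]
    using dirichlet_sum_eq_even_walsh_sum
      [where x = x and m = "2 * q" and n = "4 * q" and c = "8 * real q"] x(1) q(1)
    by (simp add: sum_negf)
  show "\<bar>\<Sum>j = 2 ^ (2 * \<alpha> k - 1)..2 ^ (2 * \<alpha> k) - 1.
          walsh (2 * j + 1) x / (2 ^ (2 * \<alpha> k + 1) - 2 * real j - 1)\<bar>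
      = \<bar>\<Sum>j = 2 ^ (2 * \<alpha> k - 1)..2 ^ (2 * \<alpha> k) - 1.
          walsh (2 * j) x / (2 ^ (2 * \<alpha> k + 1) - 2 * real j - 1)\<bar>"
    unfolding walsh_odd[of x, OF x(1)] by (simp add: sum_negf)
  show "\<bar>\<Sum>j = 2 ^ (2 * \<alpha> k - 1)..2 ^ (2 * \<alpha> k) - 1.
          walsh (2 * j) x / (2 ^ (2 * \<alpha> k + 1) - 2 * real j - 1)\<bar> \<ge> 1 / 3"
    unfolding q using even_walsh_sum_lower_bound[of x q] x(2) q(1) by simp
qed

end
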